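(* Let $S$ be an inverse semigroup with zero, $S\neq\{0\}$, and let $K$ be a field. Then the contracted inverse semigroup algebra $K_0S$ is simple if and only if $S$ is congruence-free and the singular ideal of $K_0S$ is zero.
   Context: An inverse semigroup is a semigroup $S$ in which every $s$ has a unique $s^*$ with $ss^*s=s$ and $s^*ss^*=s^*$. $E(S)$ is the set of idempotents. The contracted algebra $K_0S$ is the $K$-algebra with basis $S\setminus\{0\}$ and multiplication extending that of $S$, the zero of $S$ being identified with the zero of $K_0S$. Idempotents are ordered by $f\le e$ iff $ef=f$. An element $a\in K_0S$ is singular if for every non-zero $e\in E(S)$ there is a non-zero $f\in E(S)$ with $f\le e$ and $af=0$. The singular elements form a two-sided ideal, the singular ideal of $K_0S$. A non-empty inverse semigroup is congruence-free if its only congruences are equality and the universal relation. An algebra is simple if it is non-zero and has no two-sided ideals other than $0$ and itself. *)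

theory Defs
  imports Complex_Main
begin

section \<open>Inverse semigroups with zero\<close>

class inverse_semigroup_0 = semigroup_mult + mult_zero +
  assumes ex1_inverse: "\<exists>!t. s * t * s = s \<and> t * s * t = t"

definition idempotents :: "'s::semigroup_mult set"
  where "idempotents = {e. e * e = e}"

definition idem_le :: "'s::semigroup_mult \<Rightarrow> 's \<Rightarrow> bool"
  where "idem_le f e \<longleftrightarrow> e * f = f"

definition congruence :: "('s::semigroup_mult \<times> 's) set \<Rightarrow> bool"
  where "congruence r \<longleftrightarrow>
    equiv UNIV r \<and> (\<forall>s t u. (s, t) \<in> r \<longrightarrow> (u * s, u * t) \<in> r \<and> (s * u, t * u) \<in> r)"

definition congruence_free :: "'s::semigroup_mult itself \<Rightarrow> bool"
  where "congruence_free _ \<longleftrightarrow> (\<forall>r :: ('s \<times> 's) set. congruence r \<longrightarrow> r = Id \<or> r = UNIV)"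


section \<open>Ideals and simplicity for algebras\<close>

text \<open>
  The class \<^class>\<open>ring\<close> does not require a unit, so ideals are required to be
  linear subspaces explicitly.
\<close>

locale assoc_algebra = vector_space scale
  for scale :: "'k::field \<Rightarrow> 'b::ring \<Rightarrow> 'b" +
  assumes scale_mult_left: "scale c a * b = scale c (a * b)"
    and scale_mult_right: "a * scale c b = scale c (a * b)"

definition two_sided_ideal :: "('k::field \<Rightarrow> 'b::ring \<Rightarrow> 'b) \<Rightarrow> 'b set \<Rightarrow> bool"
  where "two_sided_ideal scale I \<longleftrightarrow>
    module.subspace scale I \<and> (\<forall>a. \<forall>x\<in>I. a * x \<in> I \<and> x * a \<in> I)"

definition simple_algebra :: "('k::field \<Rightarrow> 'b::ring \<Rightarrow> 'b) \<Rightarrow> bool"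
  where "simple_algebra scale \<longleftrightarrow>
    (\<exists>a::'b. a \<noteq> 0) \<and> (\<forall>I. two_sided_ideal scale I \<longrightarrow> I = {0} \<or> I = UNIV)"


section \<open>The contracted semigroup algebra\<close>

text \<open>
  The elements are the finitely supported coefficient functions on the semigroup that
  vanish at its zero; this is the vector space with basis the non-zero elements.
\<close>

typedef (overloaded) ('s, 'k) contracted_algebra =
    "{a :: 's::zero \<Rightarrow> 'k::zero. finite {s. a s \<noteq> 0} \<and> a 0 = 0}"
  morphisms coeff Abs_contracted_algebra
  by (rule exI[of _ "\<lambda>_. 0"]) simp

setup_lifting type_definition_contracted_algebra

lemma contracted_eqI: "(\<And>s. coeff a s = coeff b s) \<Longrightarrow> a = b"
  by (simp add: coeff_inject[symmetric] ext)

lemma finite_coeff: "finite {s. coeff a s \<noteq> 0}"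
  using coeff[of a] by simp

lemma coeff_at_0 [simp]: "coeff a 0 = 0"
  using coeff[of a] by simp

lemma finite_support_plus:
  fixes a b :: "'s \<Rightarrow> 'k::monoid_add"
  assumes "finite {s. a s \<noteq> 0}" "finite {s. b s \<noteq> 0}"
  shows "finite {s. a s + b s \<noteq> 0}"
  by (rule finite_subset[of _ "{s. a s \<noteq> 0} \<union> {s. b s \<noteq> 0}"]) (use assms in auto)

instantiation contracted_algebra :: (zero, ab_group_add) ab_group_add
begin

lift_definition zero_contracted_algebra :: "('a, 'b) contracted_algebra" is "\<lambda>_. 0"
  by simp

lift_definition plus_contracted_algebra ::
  "('a, 'b) contracted_algebra \<Rightarrow> ('a, 'b) contracted_algebra \<Rightarrow> ('a, 'b) contracted_algebra"
  is "\<lambda>a b s. a s + b s"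
  by (auto intro: finite_support_plus)

lift_definition uminus_contracted_algebra ::
  "('a, 'b) contracted_algebra \<Rightarrow> ('a, 'b) contracted_algebra"
  is "\<lambda>a s. - a s"
  by simp

definition minus_contracted_algebra ::
  "('a, 'b) contracted_algebra \<Rightarrow> ('a, 'b) contracted_algebra \<Rightarrow> ('a, 'b) contracted_algebra"
  where "minus_contracted_algebra a b = a + - b"

instance
  by standard (simp add: minus_contracted_algebra_def | transfer, simp add: fun_eq_iff algebra_simps)+

end

lemmas coeff_0 [simp] = zero_contracted_algebra.rep_eq[THEN fun_cong]
lemmas coeff_plus [simp] = plus_contracted_algebra.rep_eq[THEN fun_cong]

lift_definition scale :: "'k::field \<Rightarrow> ('s::zero, 'k) contracted_algebra \<Rightarrow> ('s, 'k) contracted_algebra"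
  is "\<lambda>c a s. c * a s"
  by (auto elim!: finite_subset[rotated])

text \<open>\<open>monomial s c\<close> is the multiple by \<open>c\<close> of the basis element \<open>s\<close>, and \<open>0\<close> if \<open>s = 0\<close>.\<close>

lift_definition monomial :: "'s::zero \<Rightarrow> 'k::zero \<Rightarrow> ('s, 'k) contracted_algebra"
  is "\<lambda>s c t. if t = s \<and> s \<noteq> 0 then c else 0"
  by (auto intro: finite_subset[of _ "{s}" for s])

definition of_semigroup :: "'s::zero \<Rightarrow> ('s, 'k::zero_neq_one) contracted_algebra"
  where "of_semigroup s = monomial s 1"

lemma coeff_sum: "coeff (sum f A) s = (\<Sum>x\<in>A. coeff (f x) s)"
  by (induction A rule: infinite_finite_induct) simp_all

lemma monomial_0_left [simp]: "monomial 0 c = 0"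
  by (transfer) simp

lemma monomial_0_right [simp]: "monomial s 0 = 0"
  by (transfer) auto

lemma monomial_add: "monomial s (c + d) = monomial s c + monomial s d"
  by (rule contracted_eqI) (simp add: monomial.rep_eq)

lemma eq_sum_monomial:
  assumes "finite A" "{s. coeff a s \<noteq> 0} \<subseteq> A"
  shows "a = (\<Sum>s\<in>A. monomial s (coeff a s))"
proof (rule contracted_eqI)
  fix t
  have "coeff (\<Sum>s\<in>A. monomial s (coeff a s)) t = (\<Sum>s\<in>A. if s = t then coeff a s else 0)"
    unfolding coeff_sum by (intro sum.cong) (auto simp: monomial.rep_eq)
  also have "\<dots> = coeff a t"
    using assms by (auto simp: sum.delta)
  finally show "coeff a t = coeff (\<Sum>s\<in>A. monomial s (coeff a s)) t" ..
qed

instantiation contracted_algebra :: ("{semigroup_mult, mult_zero}", ring) ring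
begin

definition times_contracted_algebra ::
  "('a, 'b) contracted_algebra \<Rightarrow> ('a, 'b) contracted_algebra \<Rightarrow> ('a, 'b) contracted_algebra"
  where "times_contracted_algebra a b =
    (\<Sum>s\<in>{s. coeff a s \<noteq> 0}. \<Sum>t\<in>{t. coeff b t \<noteq> 0}. monomial (s * t) (coeff a s * coeff b t))"

lemma times_contracted_superset:
  fixes a b :: "('a, 'b) contracted_algebra"
  assumes "finite A" "{s. coeff a s \<noteq> 0} \<subseteq> A" "finite B" "{t. coeff b t \<noteq> 0} \<subseteq> B"
  shows "a * b = (\<Sum>s\<in>A. \<Sum>t\<in>B. monomial (s * t) (coeff a s * coeff b t))"
proof -
  have "a * b = (\<Sum>s\<in>{s. coeff a s \<noteq> 0}. \<Sum>t\<in>B. monomial (s * t) (coeff a s * coeff b t))"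
    unfolding times_contracted_algebra_def
    using assms by (intro sum.cong refl sum.mono_neutral_left) auto
  also have "\<dots> = (\<Sum>s\<in>A. \<Sum>t\<in>B. monomial (s * t) (coeff a s * coeff b t))"
    using assms by (intro sum.mono_neutral_left) auto
  finally show ?thesis .
qed

lemma contracted_distrib_right: "(a + b) * c = a * c + b * c"
  for a b c :: "('a, 'b) contracted_algebra"
proof -
  let ?A = "{s. coeff a s \<noteq> 0} \<union> {s. coeff b s \<noteq> 0}" and ?C = "{s. coeff c s \<noteq> 0}"
  have A: "finite ?A" "finite ?C" by (simp_all add: finite_coeff)
  show ?thesis
    by (subst (1 2 3) times_contracted_superset[of ?A _ ?C])
      (use A in \<open>auto simp: distrib_right monomial_add sum.distrib\<close>)
qed

lemma contracted_distrib_left: "c * (a + b) = c * a + c * b"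
  for a b c :: "('a, 'b) contracted_algebra"
proof -
  let ?A = "{s. coeff a s \<noteq> 0} \<union> {s. coeff b s \<noteq> 0}" and ?C = "{s. coeff c s \<noteq> 0}"
  have A: "finite ?A" "finite ?C" by (simp_all add: finite_coeff)
  show ?thesis
    by (subst (1 2 3) times_contracted_superset[of ?C _ ?A])
      (use A in \<open>auto simp: distrib_left monomial_add sum.distrib\<close>)
qed

lemma monomial_mult: "monomial s c * monomial t d = monomial (s * t) (c * d)"
  for s t :: 'a and c d :: 'b
proof -
  have "monomial s c * monomial t d
      = (\<Sum>s'\<in>{s}. \<Sum>t'\<in>{t}. monomial (s' * t') (coeff (monomial s c) s' * coeff (monomial t d) t'))"
    by (rule times_contracted_superset) (auto simp: monomial.rep_eq split: if_splits)
  also have "\<dots> = monomial (s * t) (c * d)"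
    by (auto simp: monomial.rep_eq)
  finally show ?thesis .
qed

lemma contracted_mult_zero: "(0::('a, 'b) contracted_algebra) * a = 0" "a * 0 = 0"
  for a :: "('a, 'b) contracted_algebra"
  by (simp_all add: times_contracted_algebra_def)

lemma contracted_sum_mult: "sum f A * c = (\<Sum>x\<in>A. f x * c)" "c * sum f A = (\<Sum>x\<in>A. c * f x)"
  for c :: "('a, 'b) contracted_algebra"
  by (induction A rule: infinite_finite_induct;
      simp add: contracted_mult_zero contracted_distrib_left contracted_distrib_right)+

instance
proof
  fix a b c :: "('a, 'b) contracted_algebra"
  show "a * b * c = a * (b * c)"
    by (subst (1 2) eq_sum_monomial[OF finite_coeff order_refl, of a],
        subst (1 2) eq_sum_monomial[OF finite_coeff order_refl, of b],
        subst (1 2) eq_sum_monomial[OF finite_coeff order_refl, of c])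
      (simp add: contracted_sum_mult monomial_mult mult.assoc)
qed (fact contracted_distrib_left contracted_distrib_right)+

end

lemma of_semigroup_0 [simp]: "of_semigroup 0 = 0"
  by (simp add: of_semigroup_def)

lemma of_semigroup_mult:
  "of_semigroup s * of_semigroup t = (of_semigroup (s * t) ::
     ('s::{semigroup_mult, mult_zero}, 'k::ring_1) contracted_algebra)"
  by (simp add: of_semigroup_def monomial_mult)

lemma scale_monomial: "scale c (monomial s d) = monomial s (c * d)"
  by (rule contracted_eqI) (simp add: scale.rep_eq monomial.rep_eq)

interpretation contracted: assoc_algebra
  "scale :: 'k::field \<Rightarrow> ('s::{semigroup_mult, mult_zero}, 'k) contracted_algebra \<Rightarrow> _"
proof
  fix c d :: 'k and a b :: "('s, 'k) contracted_algebra"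
  show add: "scale c (a + b) = scale c a + scale c b" for a b :: "('s, 'k) contracted_algebra"
    by (rule contracted_eqI) (simp add: scale.rep_eq algebra_simps)
  show "scale (c + d) a = scale c a + scale d a"
    by (rule contracted_eqI) (simp add: scale.rep_eq algebra_simps)
  show "scale c (scale d a) = scale (c * d) a"
    by (rule contracted_eqI) (simp add: scale.rep_eq algebra_simps)
  show "scale 1 a = a"
    by (rule contracted_eqI) (simp add: scale.rep_eq)
  have zero: "scale c 0 = (0 :: ('s, 'k) contracted_algebra)"
    by (rule contracted_eqI) (simp add: scale.rep_eq)
  have sum: "scale c (sum f A) = (\<Sum>x\<in>A. scale c (f x))"
    for f :: "'s \<Rightarrow> ('s, 'k) contracted_algebra" and A
    by (induction A rule: infinite_finite_induct) (simp_all add: add zero)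
  show "scale c a * b = scale c (a * b)"
    by (subst (1 2) eq_sum_monomial[OF finite_coeff order_refl, of a],
        subst (1 2) eq_sum_monomial[OF finite_coeff order_refl, of b])
      (simp add: contracted_sum_mult sum scale_monomial monomial_mult mult.assoc)
  show "a * scale c b = scale c (a * b)"
    by (subst (1 2) eq_sum_monomial[OF finite_coeff order_refl, of a],
        subst (1 2) eq_sum_monomial[OF finite_coeff order_refl, of b])
      (simp add: contracted_sum_mult sum scale_monomial monomial_mult mult.left_commute)
qed


section \<open>Singular elements\<close>

definition singular ::
  "('s::{semigroup_mult, mult_zero}, 'k::ring_1) contracted_algebra \<Rightarrow> bool"
  where "singular a \<longleftrightarrow>
    (\<forall>e\<in>idempotents. e \<noteq> 0 \<longrightarrow>
      (\<exists>f\<in>idempotents. f \<noteq> 0 \<and> idem_le f e \<and> a * of_semigroup f = 0))"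

definition singular_ideal :: "('s::{semigroup_mult, mult_zero}, 'k::ring_1) contracted_algebra set"
  where "singular_ideal = {a. singular a}"

end

theory Submission
  imports Defs
begin

text \<open>
  If the algebra is simple, a non-trivial congruence is excluded because the kernel of the
  induced algebra map would be a proper ideal, and the singular ideal is excluded because it
  contains no non-zero idempotent of the semigroup.

  Conversely, congruence-freeness is used for two congruences only: the Rees congruences, and the
  syntactic congruence of \<open>{0}\<close>, for which \<open>s\<close> and \<open>t\<close> are related iff \<open>x s y\<close> and \<open>x t y\<close> vanish
  for the same \<open>x\<close> and \<open>y\<close>. Let \<open>a\<close> be a non-zero element of minimal support in an ideal. As \<open>a\<close> is
  not singular, there is an idempotent \<open>e \<noteq> 0\<close> with \<open>a f \<noteq> 0\<close> for all \<open>0 \<noteq> f \<le> e\<close>; by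
  minimality, right multiplication by \<open>f\<close> keeps the elements of the support non-zero and distinct.
  If the support had two elements, the syntactic congruence would provide a product \<open>x a f\<close>
  with \<open>f \<le> e\<close> in which one of the two terms vanishes and the other does not; by minimality the
  other one has to cancel, and this forces two elements of the support to agree below \<open>e\<close>. So the
  ideal contains a basis element, and then all of them by the triviality of the Rees congruences.
\<close>

section \<open>Inverse semigroups\<close>

definition semigroup_inverse :: "'s::inverse_semigroup_0 \<Rightarrow> 's"
  where "semigroup_inverse s = (THE t. s * t * s = s \<and> t * s * t = t)"

lemma mult_semigroup_inverse_mult:
  "s * semigroup_inverse s * s = s"
  "semigroup_inverse s * s * semigroup_inverse s = semigroup_inverse s"
  using theI'[OF ex1_inverse[of s]] by (auto simp: semigroup_inverse_def)

lemma semigroup_inverse_unique: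
  fixes s t u :: "'s::inverse_semigroup_0"
  assumes "s * t * s = s" "t * s * t = t" "s * u * s = s" "u * s * u = u"
  shows "t = u"
  using ex1_inverse[of s] assms by blast

lemma idempotents_iff: "e \<in> idempotents \<longleftrightarrow> e * e = e"
  by (simp add: idempotents_def)

text \<open>The inverse x of e f satisfies f x e = x, since f x e is an inverse of e f as well.
  Hence x is idempotent, and an idempotent is its own inverse, so x = e f.\<close>

lemma idempotent_mult:
  fixes e f :: "'s::inverse_semigroup_0"
  assumes "e * e = e" "f * f = f"
  shows "e * f * (e * f) = e * f"
proof -
  define x where "x = semigroup_inverse (e * f)"
  have 1: "e * f * x * (e * f) = e * f" and 2: "x * (e * f) * x = x"
    by (simp_all add: x_def mult_semigroup_inverse_mult)
  have fx: "f * x * e = x"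
  proof (rule semigroup_inverse_unique[of "e * f"])
    have "e * f * (f * x * e) * (e * f) = e * (f * f) * x * (e * e) * f"
      by (simp only: mult.assoc)
    then show "e * f * (f * x * e) * (e * f) = e * f"
      using 1 assms by (simp add: mult.assoc)
    have "f * x * e * (e * f) * (f * x * e) = f * (x * ((e * e) * (f * f)) * x) * e"
      by (simp only: mult.assoc)
    then show "f * x * e * (e * f) * (f * x * e) = f * x * e"
      using 2 assms by simp
  qed (fact 1 2)+
  have "x * x = f * (x * (e * f) * x) * e"
    by (subst (1 2) fx[symmetric]) (simp only: mult.assoc)
  then have xx: "x * x = x"
    using 2 fx by simp
  have "e * f = x"
    by (rule semigroup_inverse_unique[of x]) (use 1 2 xx in simp_all)
  then show ?thesis
    using xx by simp
qed

text \<open>Since e f is idempotent, both e f and f e are inverses of e f.\<close>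

lemma idempotents_commute:
  fixes e f :: "'s::inverse_semigroup_0"
  assumes "e * e = e" "f * f = f"
  shows "e * f = f * e"
proof (rule semigroup_inverse_unique[of "e * f"])
  note ef = idempotent_mult[OF assms] and fe = idempotent_mult[OF assms(2,1)]
  show "e * f * (e * f) * (e * f) = e * f" "e * f * (e * f) * (e * f) = e * f"
    by (simp_all add: ef)
  have "e * f * (f * e) * (e * f) = e * (f * f) * (e * e) * f"
    by (simp only: mult.assoc)
  then show "e * f * (f * e) * (e * f) = e * f"
    using ef assms by (simp add: mult.assoc)
  have "f * e * (e * f) * (f * e) = f * (e * e) * (f * f) * e"
    by (simp only: mult.assoc)
  then show "f * e * (e * f) * (f * e) = f * e"
    using fe assms by (simp add: mult.assoc)
qed

lemma idempotent_mult_inverse: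
  fixes s :: "'s::inverse_semigroup_0"
  shows "s * semigroup_inverse s * (s * semigroup_inverse s) = s * semigroup_inverse s"
    and "semigroup_inverse s * s * (semigroup_inverse s * s) = semigroup_inverse s * s"
  by (metis mult_semigroup_inverse_mult mult.assoc)+

lemma idempotent_conjugate:
  fixes s e :: "'s::inverse_semigroup_0"
  assumes "e * e = e"
  shows "s * e * semigroup_inverse s * (s * e * semigroup_inverse s) = s * e * semigroup_inverse s"
    and "semigroup_inverse s * e * s * (semigroup_inverse s * e * s) = semigroup_inverse s * e * s"
proof -
  let ?i = "semigroup_inverse s"
  have "s * e * ?i * (s * e * ?i) = s * (e * (?i * s)) * e * ?i"
    by (simp only: mult.assoc)
  also have "\<dots> = (s * ?i * s) * (e * e) * ?i"
    by (subst idempotents_commute[OF assms idempotent_mult_inverse(2)]) (simp only: mult.assoc)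
  finally show "s * e * ?i * (s * e * ?i) = s * e * ?i"
    by (simp add: assms mult_semigroup_inverse_mult)
  have "?i * e * s * (?i * e * s) = ?i * (e * (s * ?i)) * e * s"
    by (simp only: mult.assoc)
  also have "\<dots> = (?i * s * ?i) * (e * e) * s"
    by (subst idempotents_commute[OF assms idempotent_mult_inverse(1)]) (simp only: mult.assoc)
  finally show "?i * e * s * (?i * e * s) = ?i * e * s"
    by (simp add: assms mult_semigroup_inverse_mult)
qed

text \<open>An idempotent e to the left of s moves to the right as its conjugate by s. The factor f
  keeps the idempotent that acts on the right below f; the proof only commutes idempotents.\<close>

lemma mult_conjugate:
  fixes s e f :: "'s::inverse_semigroup_0"
  assumes "e * e = e" "f * f = f"
  shows "s * (f * (semigroup_inverse s * e * s)) = e * s * f"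
proof -
  let ?i = "semigroup_inverse s"
  have "s * (f * (?i * e * s)) = (s * f * ?i) * e * s"
    by (simp only: mult.assoc)
  also have "\<dots> = e * s * (f * (?i * s))"
    by (subst idempotents_commute[OF idempotent_conjugate(1)[OF assms(2)] assms(1)])
      (simp only: mult.assoc)
  also have "\<dots> = e * (s * ?i * s) * f"
    by (subst idempotents_commute[OF assms(2) idempotent_mult_inverse(2)]) (simp only: mult.assoc)
  finally show ?thesis
    by (simp add: mult_semigroup_inverse_mult)
qed

text \<open>Cancels x at the price of a smaller idempotent. With p = x' x for the inverse x' of x,
  the elements p s f and p u f are one element t. By \<open>mult_conjugate\<close>, t is s times
  \<open>k s\<close> and u times \<open>k u\<close> for idempotents \<open>k s\<close>,
  \<open>k u\<close> below f, each of which fixes t on the right. So g can be their product.\<close>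

lemma agree_below_idempotent:
  fixes x s u f :: "'s::inverse_semigroup_0"
  assumes f: "f * f = f" and eq: "x * s * f = x * u * f" and nz: "x * s * f \<noteq> 0"
  obtains g where "g * g = g" "f * g = g" "s * g = u * g" "s * g \<noteq> 0"
proof -
  define p where "p = semigroup_inverse x * x"
  define t where "t = p * s * f"
  define k where "k v = f * (semigroup_inverse v * p * v)" for v
  have p: "p * p = p"
    by (simp add: p_def idempotent_mult_inverse)
  have t2: "t = p * u * f"
    by (metis t_def p_def eq mult.assoc)
  have "x * t = (x * semigroup_inverse x * x) * s * f"
    by (simp only: t_def p_def mult.assoc)
  then have t_nz: "t \<noteq> 0"
    using nz by (auto simp: mult_semigroup_inverse_mult)
  have k_idem: "k v * k v = k v" for v
    unfolding k_def by (rule idempotent_mult[OF f idempotent_conjugate(2)[OF p]])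
  have fk: "f * k v = k v" for v
    by (simp add: k_def f mult.assoc[symmetric])
  have pt: "p * t = t"
    by (simp add: t_def p mult.assoc[symmetric])
  have sk: "s * k s = t" and uk: "u * k u = t"
    using mult_conjugate[OF p f] t_def t2 by (simp_all add: k_def)
  have "t * k s = p * (s * (f * k s))" "t * k u = p * (u * (f * k u))"
    by (simp_all only: t_def mult.assoc) (simp only: t_def[symmetric] t2 mult.assoc[symmetric])
  then have tk: "t * k s = t" "t * k u = t"
    by (simp_all add: fk sk uk pt)
  have "s * (k s * k u) = t"
    by (simp add: sk tk mult.assoc[symmetric])
  moreover have "u * (k s * k u) = t"
    by (subst idempotents_commute[OF k_idem k_idem]) (simp add: uk tk mult.assoc[symmetric])
  moreover have "f * (k s * k u) = k s * k u"
    by (simp add: fk mult.assoc[symmetric])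
  ultimately show thesis
    using that[of "k s * k u"] idempotent_mult[OF k_idem k_idem] t_nz by metis
qed

section \<open>Syntactic and Rees congruences\<close>

lemma congruence_refl: "congruence r \<Longrightarrow> (s, s) \<in> r"
  by (auto simp: congruence_def equiv_def refl_on_def)

lemma congruence_syntactic:
  "congruence {(s, t :: 's::{semigroup_mult, zero}). \<forall>x y. x * s * y = 0 \<longleftrightarrow> x * t * y = 0}"
  unfolding congruence_def equiv_def refl_on_def sym_def trans_def
  by (auto; metis mult.assoc)

lemma syntactic_separation:
  fixes s t :: "'s::inverse_semigroup_0"
  assumes cf: "congruence_free TYPE('s)" and "s \<noteq> t"
  obtains x y where "(x * s * y = 0) \<noteq> (x * t * y = 0)"
proof -
  let ?r = "{(s, t :: 's). \<forall>x y. x * s * y = 0 \<longleftrightarrow> x * t * y = 0}"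
  have "?r = Id \<or> ?r = UNIV"
    using cf congruence_syntactic unfolding congruence_free_def by blast
  moreover have "?r \<noteq> UNIV"
  proof
    assume r: "?r = UNIV"
    \<comment> \<open>The contexts x, y contain no adjoined identity, so v is reached through its
      inverse v': if v' is related to 0, the context x = y = v gives v = v v' v = 0.\<close>
    have "v = 0" for v :: 's
    proof -
      let ?i = "semigroup_inverse v"
      have "(?i, 0) \<in> ?r"
        using r by blast
      then have "v * ?i * v = 0"
        by simp
      then show ?thesis
        by (simp add: mult_semigroup_inverse_mult)
    qed
    then show False
      using \<open>s \<noteq> t\<close> by metis
  qed
  ultimately have "(s, t) \<notin> ?r"
    using \<open>s \<noteq> t\<close> by auto
  then show thesis
    using that by blast
qed

lemma congruence_Rees:
  fixes J :: "'s::semigroup_mult set"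
  assumes "\<And>s t. s \<in> J \<Longrightarrow> t * s \<in> J" "\<And>s t. s \<in> J \<Longrightarrow> s * t \<in> J"
  shows "congruence (J \<times> J \<union> Id)"
  using assms unfolding congruence_def equiv_def refl_on_def sym_def trans_def by auto

text \<open>The Rees congruence of J collapses J to a point. It relates s to 0, so it is universal;
  then every non-zero t is related to 0 and lies in J.\<close>

lemma semigroup_ideal_eq_UNIV:
  fixes J :: "'s::{semigroup_mult, mult_zero} set"
  assumes cf: "congruence_free TYPE('s)"
    and J: "\<And>s t. s \<in> J \<Longrightarrow> t * s \<in> J" "\<And>s t. s \<in> J \<Longrightarrow> s * t \<in> J"
    and s: "s \<in> J" "s \<noteq> 0"
  shows "J = UNIV"
proof -
  have 0: "0 \<in> J"
    using J(1)[OF s(1), of 0] by simp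
  have "J \<times> J \<union> Id = Id \<or> J \<times> J \<union> Id = UNIV"
    using cf congruence_Rees[OF J] unfolding congruence_free_def by blast
  moreover have "(s, 0) \<in> J \<times> J \<union> Id" "(s, 0) \<notin> Id"
    using s 0 by auto
  ultimately have r: "J \<times> J \<union> Id = UNIV"
    by metis
  have "t \<in> J" for t
    using r 0 by (cases "t = 0") auto
  then show ?thesis
    by blast
qed

section \<open>The contracted algebra\<close>

lemma of_semigroup_eq_0_iff:
  "(of_semigroup s :: ('s::zero, 'k::ring_1) contracted_algebra) = 0 \<longleftrightarrow> s = 0"
  by (metis coeff_0 monomial.rep_eq of_semigroup_0 of_semigroup_def zero_neq_one)

text \<open>The empty sum needs no case of its own, because 0 is
  \<open>monomial 0 0\<close>.\<close>

lemma contracted_algebra_induct: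
  fixes a :: "('s::{semigroup_mult, mult_zero}, 'k::ring) contracted_algebra"
  assumes mono: "\<And>s c. P (monomial s c)" and add: "\<And>a b. P a \<Longrightarrow> P b \<Longrightarrow> P (a + b)"
  shows "P a"
proof -
  have "P (\<Sum>s\<in>A. monomial s (coeff a s))" for A
  proof (induction A rule: infinite_finite_induct)
    case (insert s A)
    then show ?case
      by (simp add: mono add)
  qed (use mono[of 0 0] in simp_all)
  then have "P (\<Sum>s\<in>{s. coeff a s \<noteq> 0}. monomial s (coeff a s))" .
  then show ?thesis
    by (simp only: eq_sum_monomial[OF finite_coeff order_refl, of a, symmetric])
qed

lemma monomial_eq_scale:
  "monomial s c = (scale c (of_semigroup s) :: ('s::zero, 'k::field) contracted_algebra)"
  by (simp add: of_semigroup_def scale_monomial)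

lemma mult_of_semigroup_eq_sum:
  fixes a :: "('s::{semigroup_mult, mult_zero}, 'k::ring_1) contracted_algebra"
  shows "a * of_semigroup f = (\<Sum>s\<in>{s. coeff a s \<noteq> 0}. monomial (s * f) (coeff a s))"
  by (subst eq_sum_monomial[OF finite_coeff order_refl, of a])
    (simp add: contracted_sum_mult of_semigroup_def monomial_mult)

lemma of_semigroup_mult_mult_eq_sum:
  fixes a :: "('s::{semigroup_mult, mult_zero}, 'k::ring_1) contracted_algebra"
  shows "of_semigroup x * a * of_semigroup f =
    (\<Sum>s\<in>{s. coeff a s \<noteq> 0}. monomial (x * s * f) (coeff a s))"
  by (subst eq_sum_monomial[OF finite_coeff order_refl, of a])
    (simp add: contracted_sum_mult of_semigroup_def monomial_mult)

text \<open>Terms may merge, cancel or vanish, but no new basis elements appear. This bounds the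
  supports of products in the minimality arguments.\<close>

lemma support_sum_monomial:
  "{r. coeff (\<Sum>s\<in>A. monomial (h s) (c s)) r \<noteq> 0} \<subseteq> h ` A - {0}"
proof
  fix r assume r: "r \<in> {r. coeff (\<Sum>s\<in>A. monomial (h s) (c s)) r \<noteq> 0}"
  then obtain s where "s \<in> A" "coeff (monomial (h s) (c s)) r \<noteq> 0"
    unfolding coeff_sum mem_Collect_eq by (rule sum.not_neutral_contains_not_neutral)
  then show "r \<in> h ` A - {0}"
    by (auto simp: monomial.rep_eq split: if_splits)
qed

section \<open>Two-sided ideals of the contracted algebra\<close>

lemma two_sided_idealD:
  fixes I :: "('s::{semigroup_mult, mult_zero}, 'k::field) contracted_algebra set"
  assumes "two_sided_ideal scale I"
  shows "0 \<in> I" "a \<in> I \<Longrightarrow> b \<in> I \<Longrightarrow> a + b \<in> I" "a \<in> I \<Longrightarrow> scale c a \<in> I"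
    "a \<in> I \<Longrightarrow> d * a \<in> I" "a \<in> I \<Longrightarrow> a * d \<in> I"
  using assms unfolding two_sided_ideal_def contracted.subspace_def by auto

text \<open>Multiplication by a general element is a linear combination of multiplications by basis
  elements.\<close>

lemma two_sided_ideal_by_monomials:
  fixes I :: "('s::{semigroup_mult, mult_zero}, 'k::field) contracted_algebra set"
  assumes "0 \<in> I" and add: "\<And>a b. a \<in> I \<Longrightarrow> b \<in> I \<Longrightarrow> a + b \<in> I"
    and sc: "\<And>c a. a \<in> I \<Longrightarrow> scale c a \<in> I"
    and left: "\<And>s a. a \<in> I \<Longrightarrow> of_semigroup s * a \<in> I"
    and right: "\<And>s a. a \<in> I \<Longrightarrow> a * of_semigroup s \<in> I"
  shows "two_sided_ideal scale I"
proof -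
  have "b * a \<in> I \<and> a * b \<in> I" if a: "a \<in> I" for a b
  proof (induction b rule: contracted_algebra_induct)
    case (1 s c)
    then show ?case
      by (simp add: monomial_eq_scale contracted.scale_mult_left contracted.scale_mult_right
          sc left right a)
  qed (simp add: contracted_distrib_left contracted_distrib_right add)
  with assms show ?thesis
    unfolding two_sided_ideal_def contracted.subspace_def by auto
qed

section \<open>Ideals of congruences\<close>

text \<open>The value of \<phi> at 0 never enters, as 0 is not a basis element. Products that become
  0 are therefore treated correctly only when \<phi> vanishes at 0.\<close>

definition linear_extension :: "('s \<Rightarrow> 'k) \<Rightarrow> ('s::zero, 'k::field) contracted_algebra \<Rightarrow> 'k"
  where "linear_extension \<phi> a = (\<Sum>s\<in>{s. coeff a s \<noteq> 0}. coeff a s * \<phi> s)"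

lemma linear_extension_superset:
  assumes "finite A" "{s. coeff a s \<noteq> 0} \<subseteq> A"
  shows "linear_extension \<phi> a = (\<Sum>s\<in>A. coeff a s * \<phi> s)"
  unfolding linear_extension_def using assms by (intro sum.mono_neutral_left) auto

lemma linear_extension_add:
  "linear_extension \<phi> (a + b) = linear_extension \<phi> a + linear_extension \<phi> b"
proof -
  let ?A = "{s. coeff a s \<noteq> 0} \<union> {s. coeff b s \<noteq> 0}"
  have "finite ?A"
    by (simp add: finite_coeff)
  then show ?thesis
    by (subst (1 2 3) linear_extension_superset[of ?A])
      (auto simp: distrib_right sum.distrib)
qed

lemma linear_extension_scale: "linear_extension \<phi> (scale c a) = c * linear_extension \<phi> a"
  by (subst (1 2) linear_extension_superset[of "{s. coeff a s \<noteq> 0}"])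
    (auto simp: finite_coeff scale.rep_eq sum_distrib_left mult.assoc)

lemma linear_extension_monomial:
  assumes "\<phi> 0 = 0"
  shows "linear_extension \<phi> (monomial s c) = c * \<phi> s"
  by (subst linear_extension_superset[of "{s}"])
    (use assms in \<open>auto simp: monomial.rep_eq split: if_splits\<close>)

lemma linear_extension_mult:
  fixes a :: "('s::{semigroup_mult, mult_zero}, 'k::field) contracted_algebra"
  assumes "\<phi> 0 = 0"
  shows "linear_extension \<phi> (of_semigroup t * a) = linear_extension (\<lambda>s. \<phi> (t * s)) a"
    and "linear_extension \<phi> (a * of_semigroup t) = linear_extension (\<lambda>s. \<phi> (s * t)) a"
  by (induction a rule: contracted_algebra_induct)
    (simp_all add: of_semigroup_def monomial_mult linear_extension_monomial assms
      contracted_distrib_left contracted_distrib_right linear_extension_add)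

text \<open>
  The kernel of the map onto the contracted algebra of the quotient by \<open>r\<close>, described by the
  functionals that factor through this map.
\<close>

definition congruence_ideal ::
  "('s \<times> 's) set \<Rightarrow> ('s::{semigroup_mult, mult_zero}, 'k::field) contracted_algebra set"
  where "congruence_ideal r =
    {a. \<forall>\<phi>. \<phi> 0 = 0 \<longrightarrow> (\<forall>(s, t)\<in>r. \<phi> s = \<phi> t) \<longrightarrow> linear_extension \<phi> a = 0}"

text \<open>Evaluating \<phi> after multiplication by u is evaluating a translate of \<phi>. The
  translate again vanishes at 0 and is constant on the classes of \<open>r\<close>, because
  \<open>r\<close> is compatible with multiplication.\<close>

lemma two_sided_ideal_congruence_ideal:
  fixes r :: "('s::{semigroup_mult, mult_zero} \<times> 's) set"
  assumes "congruence r"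
  shows "two_sided_ideal scale
    (congruence_ideal r :: ('s, 'k::field) contracted_algebra set)"
proof (rule two_sided_ideal_by_monomials)
  fix u and a :: "('s, 'k) contracted_algebra"
  assume a: "a \<in> congruence_ideal r"
  have r: "(u * s, u * t) \<in> r" "(s * u, t * u) \<in> r" if "(s, t) \<in> r" for s t
    using assms that unfolding congruence_def by auto
  show "of_semigroup u * a \<in> congruence_ideal r"
    unfolding congruence_ideal_def
  proof (intro CollectI allI impI)
    fix \<phi> :: "'s \<Rightarrow> 'k" assume "\<phi> 0 = 0" "\<forall>(s, t)\<in>r. \<phi> s = \<phi> t"
    with a r show "linear_extension \<phi> (of_semigroup u * a) = 0"
      unfolding congruence_ideal_def mem_Collect_eq linear_extension_mult(1)[of \<phi>, OF \<open>\<phi> 0 = 0\<close>]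
      by (elim allE[of _ "\<lambda>s. \<phi> (u * s)"]) (auto split: prod.splits, blast)
  qed
  show "a * of_semigroup u \<in> congruence_ideal r"
    unfolding congruence_ideal_def
  proof (intro CollectI allI impI)
    fix \<phi> :: "'s \<Rightarrow> 'k" assume "\<phi> 0 = 0" "\<forall>(s, t)\<in>r. \<phi> s = \<phi> t"
    with a r show "linear_extension \<phi> (a * of_semigroup u) = 0"
      unfolding congruence_ideal_def mem_Collect_eq linear_extension_mult(2)[of \<phi>, OF \<open>\<phi> 0 = 0\<close>]
      by (elim allE[of _ "\<lambda>s. \<phi> (s * u)"]) (auto split: prod.splits, blast)
  qed
qed (auto simp: congruence_ideal_def linear_extension_add linear_extension_scale
    linear_extension_def[of _ 0])

lemma simple_imp_congruence_free:
  assumes simple: "simple_algebra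
    (scale :: 'k::field \<Rightarrow> ('s::inverse_semigroup_0, 'k) contracted_algebra \<Rightarrow> _)"
  shows "congruence_free TYPE('s)"
  unfolding congruence_free_def
proof (intro allI impI)
  fix r :: "('s \<times> 's) set"
  assume r: "congruence r"
  have sym: "(s, t) \<in> r \<Longrightarrow> (t, s) \<in> r"
    and trans: "(s, t) \<in> r \<Longrightarrow> (t, u) \<in> r \<Longrightarrow> (s, u) \<in> r" for s t u
    using r by (meson congruence_def equiv_def symD transD)+
  let ?I = "congruence_ideal r :: ('s, 'k) contracted_algebra set"
  have "?I = {0} \<or> ?I = UNIV"
    using simple two_sided_ideal_congruence_ideal[OF r] unfolding simple_algebra_def by blast
  then show "r = Id \<or> r = UNIV"
  proof
    assume I: "?I = {0}"
    have "s = t" if st: "(s, t) \<in> r" for s t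
    proof (rule ccontr)
      assume ne: "s \<noteq> t"
      \<comment> \<open>One of s and t may be 0 and drop out of \<open>?a\<close>. The coefficient
        at the other is still 1 or -1, so both coefficients are inspected.\<close>
      let ?a = "monomial s 1 + monomial t (- 1) :: ('s, 'k) contracted_algebra"
      have "?a \<in> ?I"
        using st by (auto simp: congruence_ideal_def linear_extension_add linear_extension_monomial)
      then have "coeff ?a s = 0" "coeff ?a t = 0"
        using I by simp_all
      then show False
        using ne by (auto simp: monomial.rep_eq split: if_splits)
    qed
    then show ?thesis
      using congruence_refl[OF r] by auto
  next
    assume I: "?I = UNIV"
    have "(s, 0) \<in> r" for s
    proof (rule ccontr)
      assume s: "(s, 0) \<notin> r"
      \<comment> \<open>The indicator of the class of s: it vanishes at 0 because s is not related
        to 0, and thus separates s from 0 in the quotient.\<close>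
      define \<phi> :: "'s \<Rightarrow> 'k" where "\<phi> t = (if (t, s) \<in> r then 1 else 0)" for t
      have "\<phi> 0 = 0"
        using s sym[of 0 s] by (auto simp: \<phi>_def)
      moreover have "\<forall>(t, u)\<in>r. \<phi> t = \<phi> u"
      proof (clarify)
        fix t u assume "(t, u) \<in> r"
        then have "(t, s) \<in> r \<longleftrightarrow> (u, s) \<in> r"
          using sym trans by blast
        then show "\<phi> t = \<phi> u"
          by (simp add: \<phi>_def)
      qed
      moreover have "monomial s 1 \<in> ?I"
        by (simp add: I)
      ultimately have "linear_extension \<phi> (monomial s 1) = 0"
        by (auto simp: congruence_ideal_def)
      moreover have "\<phi> s = 1"
        by (simp add: \<phi>_def congruence_refl[OF r])
      ultimately show False
        by (simp add: linear_extension_monomial \<open>\<phi> 0 = 0\<close>)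
    qed
    then have "(s, t) \<in> r" for s t
      using trans[OF _ sym, of s 0 t] by simp
    then show ?thesis
      by auto
  qed
qed

section \<open>The singular ideal\<close>

lemma singularE:
  assumes "singular a" "e * e = e" "e \<noteq> 0"
  obtains f where "f * f = f" "f \<noteq> 0" "e * f = f" "a * of_semigroup f = 0"
proof -
  have "e \<in> idempotents"
    by (simp add: idempotents_iff assms)
  then obtain f where "f \<in> idempotents" "f \<noteq> 0" "idem_le f e" "a * of_semigroup f = 0"
    using assms(1,3) unfolding singular_def by blast
  then show thesis
    using that by (simp add: idempotents_iff idem_le_def)
qed

lemma singularI:
  fixes a :: "('s::{semigroup_mult, mult_zero}, 'k::ring_1) contracted_algebra"
  assumes "\<And>e. e * e = e \<Longrightarrow> e \<noteq> 0 \<Longrightarrow>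
    \<exists>f. f * f = f \<and> f \<noteq> 0 \<and> e * f = f \<and> a * of_semigroup f = 0"
  shows "singular a"
  unfolding singular_def
proof (intro ballI impI)
  fix e :: 's assume "e \<in> idempotents" "e \<noteq> 0"
  then obtain f where "f * f = f" "f \<noteq> 0" "e * f = f" "a * of_semigroup f = 0"
    using assms by (auto simp: idempotents_iff)
  then show "\<exists>f\<in>idempotents. f \<noteq> 0 \<and> idem_le f e \<and> a * of_semigroup f = 0"
    by (auto simp: idempotents_iff idem_le_def)
qed

text \<open>The idempotent shrinks twice: f below e with a f = 0, then g below f with b g = 0; still
  a g = a f g = 0.\<close>

lemma singular_add:
  fixes a b :: "('s::inverse_semigroup_0, 'k::ring_1) contracted_algebra"
  assumes a: "singular a" and b: "singular b"
  shows "singular (a + b)"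
proof (rule singularI)
  fix e :: 's assume e: "e * e = e" "e \<noteq> 0"
  obtain f where f: "f * f = f" "f \<noteq> 0" "e * f = f" "a * of_semigroup f = 0"
    using singularE[OF a e] .
  obtain g where g: "g * g = g" "g \<noteq> 0" "f * g = g" "b * of_semigroup g = 0"
    using singularE[OF b f(1,2)] .
  have "a * of_semigroup g = a * of_semigroup f * of_semigroup g"
    by (simp add: mult.assoc of_semigroup_mult g)
  then have "(a + b) * of_semigroup g = 0"
    by (simp add: distrib_right f g)
  moreover have "e * g = g"
    by (metis f(3) g(3) mult.assoc)
  ultimately show "\<exists>g. g * g = g \<and> g \<noteq> 0 \<and> e * g = g \<and> (a + b) * of_semigroup g = 0"
    using g by blast
qed

text \<open>Singularity is tested on the right, so left multiples are immediate and right multiples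
  are not. If t e is non-zero, so is t e t', with t' the inverse of t. An f below it with a f = 0 is
  pulled back to t' f t, which lies below e and satisfies t t' f t = f t.\<close>

lemma singular_mult_of_semigroup:
  fixes a :: "('s::inverse_semigroup_0, 'k::ring_1) contracted_algebra"
  assumes a: "singular a"
  shows "singular (a * of_semigroup t)"
proof (rule singularI)
  fix e :: 's assume e: "e * e = e" "e \<noteq> 0"
  let ?i = "semigroup_inverse t" and ?b = "a * of_semigroup t"
  show "\<exists>f. f * f = f \<and> f \<noteq> 0 \<and> e * f = f \<and> ?b * of_semigroup f = 0"
  proof (cases "t * e = 0")
    case True
    then have "?b * of_semigroup e = 0"
      by (simp add: mult.assoc of_semigroup_mult)
    then show ?thesis
      using e by blast
  next
    case False
    let ?g = "t * e * ?i"
    have "?g * t * e = t * e"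
      by (metis e(1) idempotents_commute idempotent_mult_inverse(2) mult.assoc
          mult_semigroup_inverse_mult(1))
    then have "?g \<noteq> 0"
      using False by auto
    then obtain f where f: "f * f = f" "f \<noteq> 0" "?g * f = f" "a * of_semigroup f = 0"
      using singularE[OF a idempotent_conjugate(1)[OF e(1), of t]] by blast
    have tt: "t * ?i * f = f"
    proof -
      have "t * ?i * (?g * f) = (t * ?i * t) * e * ?i * f"
        by (simp only: mult.assoc)
      then show ?thesis
        using f(3) by (simp add: mult_semigroup_inverse_mult)
    qed
    let ?f = "?i * f * t"
    have tf: "t * ?f = f * t"
      using tt by (simp add: mult.assoc[symmetric])
    have "?f * ?f = ?f"
      by (rule idempotent_conjugate(2)[OF f(1)])
    \<comment> \<open>Conjugating back, t \<open>?f\<close> t' = f, so the pullback cannot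
      vanish.\<close>
    moreover have "?f \<noteq> 0"
    proof
      assume "?f = 0"
      then have "f * t * ?i = 0"
        by (metis tf mult_zero_left mult_zero_right)
      moreover have "f * (t * ?i) = f"
        using tt idempotents_commute[OF f(1) idempotent_mult_inverse(1)[of t]] by simp
      ultimately show False
        using f(2) by (simp add: mult.assoc)
    qed
    moreover have "e * ?f = ?f"
    proof -
      have "e * (?i * t) = ?i * t * e"
        by (rule idempotents_commute[OF e(1) idempotent_mult_inverse(2)])
      then have *: "e * ?i = ?i * ?g"
        by (metis mult.assoc mult_semigroup_inverse_mult(2))
      have "e * ?f = (e * ?i) * f * t"
        by (simp only: mult.assoc)
      also have "\<dots> = ?i * (?g * f) * t"
        by (subst *) (simp only: mult.assoc)
      finally show ?thesis
        by (simp only: f(3))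
    qed
    moreover have "?b * of_semigroup ?f = a * of_semigroup f * of_semigroup t"
      by (simp add: mult.assoc of_semigroup_mult) (metis tf mult.assoc)
    then have "?b * of_semigroup ?f = 0"
      by (simp add: f)
    ultimately show ?thesis
      by blast
  qed
qed

lemma two_sided_ideal_singular_ideal:
  "two_sided_ideal scale
    (singular_ideal :: ('s::inverse_semigroup_0, 'k::field) contracted_algebra set)"
proof (rule two_sided_ideal_by_monomials)
  fix s :: 's and c :: 'k and a b :: "('s, 'k) contracted_algebra"
  assume a: "a \<in> singular_ideal"
  show "scale c a \<in> singular_ideal"
    using a unfolding singular_ideal_def singular_def mem_Collect_eq
    by (metis contracted.scale_mult_left contracted.scale_zero_right)
  show "of_semigroup s * a \<in> singular_ideal"
    using a unfolding singular_ideal_def singular_def mem_Collect_eq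
    by (metis mult.assoc mult_zero_right)
  show "a * of_semigroup s \<in> singular_ideal"
    using a by (simp add: singular_ideal_def singular_mult_of_semigroup)
  show "a + b \<in> singular_ideal" if "b \<in> singular_ideal"
    using a that by (simp add: singular_ideal_def singular_add)
next
  show "0 \<in> (singular_ideal :: ('s, 'k) contracted_algebra set)"
    by (auto simp: singular_ideal_def intro!: singularI)
qed

text \<open>Multiplication by e fixes every f below e, so it annihilates no non-zero one.\<close>

lemma singular_of_semigroup_idempotent:
  assumes "e * e = e"
    and "singular (of_semigroup e :: ('s::{semigroup_mult, mult_zero}, 'k::ring_1) contracted_algebra)"
  shows "e = 0"
proof (rule ccontr)
  assume "e \<noteq> 0"
  with assms obtain f where "f \<noteq> 0" "e * f = f"
    "(of_semigroup e :: ('s, 'k) contracted_algebra) * of_semigroup f = 0"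
    by (blast elim: singularE)
  then show False
    by (simp add: of_semigroup_mult of_semigroup_eq_0_iff)
qed

lemma simple_imp_singular_ideal_trivial:
  assumes "simple_algebra
    (scale :: 'k::field \<Rightarrow> ('s::inverse_semigroup_0, 'k) contracted_algebra \<Rightarrow> _)"
    and "(s :: 's) \<noteq> 0"
  shows "(singular_ideal :: ('s, 'k) contracted_algebra set) = {0}"
proof (rule ccontr)
  let ?e = "s * semigroup_inverse s"
  assume "(singular_ideal :: ('s, 'k) contracted_algebra set) \<noteq> {0}"
  then have "(singular_ideal :: ('s, 'k) contracted_algebra set) = UNIV"
    using assms(1) two_sided_ideal_singular_ideal unfolding simple_algebra_def by blast
  then have "(of_semigroup ?e :: ('s, 'k) contracted_algebra) \<in> singular_ideal"
    by simp
  then have "?e = 0"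
    unfolding singular_ideal_def mem_Collect_eq
    by (rule singular_of_semigroup_idempotent[OF idempotent_mult_inverse(1)])
  then have "s = 0"
    using mult_semigroup_inverse_mult(1)[of s] by simp
  then show False
    using assms(2) by simp
qed

section \<open>Elements of minimal support\<close>

lemma minimal_support_singleton:
  fixes I :: "('s::inverse_semigroup_0, 'k::field) contracted_algebra set"
  assumes I: "two_sided_ideal scale I" and cf: "congruence_free TYPE('s)"
    and a: "a \<in> I" "\<not> singular a"
    and minimal: "\<And>b. b \<in> I \<Longrightarrow> b \<noteq> 0 \<Longrightarrow>
      card {s. coeff a s \<noteq> 0} \<le> card {s. coeff b s \<noteq> 0}"
    and s: "coeff a s \<noteq> 0" and u: "coeff a u \<noteq> 0"
  shows "s = u"
proof -
  let ?A = "{s. coeff a s \<noteq> 0}"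
  obtain e where e: "e * e = e" "e \<noteq> 0"
    and ns: "\<And>f. f * f = f \<Longrightarrow> f \<noteq> 0 \<Longrightarrow> e * f = f \<Longrightarrow> a * of_semigroup f \<noteq> 0"
    using a(2) singularI[of a] by blast
  \<comment> \<open>The support of a f lies in the image of \<open>?A\<close>. As a f is non-zero by
    the choice of e, minimality prevents this image from being smaller than
    \<open>?A\<close>.\<close>
  have inj: "inj_on (\<lambda>s. s * f) ?A" if f: "f * f = f" "f \<noteq> 0" "e * f = f" for f
  proof (rule eq_card_imp_inj_on[OF finite_coeff antisym])
    show "card ((\<lambda>s. s * f) ` ?A) \<le> card ?A"
      by (rule card_image_le[OF finite_coeff])
    have "card ?A \<le> card {s. coeff (a * of_semigroup f) s \<noteq> 0}"
      using minimal two_sided_idealD(5)[OF I a(1)] ns[OF f] by blast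
    also have "\<dots> \<le> card ((\<lambda>s. s * f) ` ?A)"
      unfolding mult_of_semigroup_eq_sum
      using support_sum_monomial[of "\<lambda>s. s * f" "coeff a" ?A]
      by (intro card_mono) (auto simp: finite_coeff)
    finally show "card ?A \<le> card ((\<lambda>s. s * f) ` ?A)" .
  qed
  \<comment> \<open>The factor e in the context keeps the idempotents constructed here below e,
    where right multiplication is injective on the support.\<close>
  have no_separation: "x * t * e * y \<noteq> 0"
    if t: "coeff a t \<noteq> 0" and v: "coeff a v \<noteq> 0" "x * v * e * y \<noteq> 0" for t v x y
  proof
    assume t0: "x * t * e * y = 0"
    \<comment> \<open>Replaces the right factor e y by an idempotent below e. The same products
      vanish, since multiplying by y again restores e y.\<close>
    define f where "f = e * (y * semigroup_inverse y)"
    have f: "f * f = f" "e * f = f"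
      using idempotent_mult[OF e(1) idempotent_mult_inverse(1)] e(1)
      by (simp_all add: f_def mult.assoc[symmetric])
    have xtf: "x * t * f = 0"
      using t0 by (simp add: f_def mult.assoc[symmetric])
    have "x * v * f * y = x * v * e * (y * semigroup_inverse y * y)"
      by (simp only: f_def mult.assoc)
    then have xvf: "x * v * f \<noteq> 0"
      using v(2) by (auto simp: mult_semigroup_inverse_mult)
    let ?b = "of_semigroup x * a * of_semigroup f" and ?h = "\<lambda>s. x * s * f"
    \<comment> \<open>The term of t is lost, so the support of \<open>?b\<close> is smaller than
      that of a, and minimality forces \<open>?b\<close> = 0.\<close>
    have "{s. coeff ?b s \<noteq> 0} \<subseteq> ?h ` (?A - {t})"
      using support_sum_monomial[of ?h "coeff a" ?A] xtf
      unfolding of_semigroup_mult_mult_eq_sum by auto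
    then have "card {s. coeff ?b s \<noteq> 0} \<le> card (?h ` (?A - {t}))"
      by (intro card_mono) (simp_all add: finite_coeff)
    also have "\<dots> \<le> card (?A - {t})"
      by (rule card_image_le) (simp add: finite_coeff)
    also have "\<dots> < card ?A"
      using t by (intro psubset_card_mono) (auto simp: finite_coeff)
    finally have b: "?b = 0"
      using minimal[of ?b] two_sided_idealD(4,5)[OF I] a(1) by (meson not_le)
    \<comment> \<open>The term of v is non-zero while the sum \<open>?b\<close> vanishes, so another
      term falls on the same basis element.\<close>
    have "\<exists>w. coeff a w \<noteq> 0 \<and> w \<noteq> v \<and> x * w * f = x * v * f"
    proof (rule ccontr)
      assume *: "\<not> ?thesis"
      have "coeff ?b (x * v * f) = (\<Sum>w\<in>?A. if w = v then coeff a w else 0)"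
        unfolding of_semigroup_mult_mult_eq_sum coeff_sum
        by (intro sum.cong refl) (use * xvf in \<open>auto simp: monomial.rep_eq\<close>)
      also have "\<dots> = coeff a v"
        using v(1) by (simp add: sum.delta finite_coeff)
      finally show False
        using b v(1) by simp
    qed
    then obtain w where w: "coeff a w \<noteq> 0" "w \<noteq> v" "x * w * f = x * v * f"
      by blast
    \<comment> \<open>The left factor x is removed below f; the resulting collision of w and v under
      g contradicts injectivity.\<close>
    obtain g where g: "g * g = g" "f * g = g" "w * g = v * g" "w * g \<noteq> 0"
      using agree_below_idempotent[OF f(1) w(3)] xvf w(3) by auto
    have "e * g = g"
      by (metis f(2) g(2) mult.assoc)
    moreover have "g \<noteq> 0"
      using g(4) by auto
    ultimately have "w = v"
      using inj_onD[OF inj[OF g(1)]] g(3) w(1) v(1) by blast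
    with w(2) show False ..
  qed
  show ?thesis
  proof (rule ccontr)
    assume "s \<noteq> u"
    \<comment> \<open>Separating s e from u e, rather than s from u, produces a context containing
      e, as \<open>no_separation\<close> requires.\<close>
    then have "s * e \<noteq> u * e"
      using inj_onD[OF inj[OF e e(1)]] s u by blast
    then obtain x y where "(x * (s * e) * y = 0) \<noteq> (x * (u * e) * y = 0)"
      using syntactic_separation[OF cf] by blast
    then show False
      using no_separation[OF s u, of x y] no_separation[OF u s, of x y]
      by (auto simp: mult.assoc)
  qed
qed

lemma congruence_free_imp_ideal_eq_UNIV:
  fixes I :: "('s::inverse_semigroup_0, 'k::field) contracted_algebra set"
  assumes I: "two_sided_ideal scale I" and cf: "congruence_free TYPE('s)"
    and sing: "(singular_ideal :: ('s, 'k) contracted_algebra set) = {0}"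
    and "I \<noteq> {0}"
  shows "I = UNIV"
proof -
  have "\<exists>a. a \<in> I \<and> a \<noteq> 0"
    using \<open>I \<noteq> {0}\<close> two_sided_idealD(1)[OF I] by blast
  then obtain a where a: "a \<in> I" "a \<noteq> 0"
    and minimal: "\<And>b. b \<in> I \<Longrightarrow> b \<noteq> 0 \<Longrightarrow>
      card {s. coeff a s \<noteq> 0} \<le> card {s. coeff b s \<noteq> 0}"
    using ex_has_least_nat[of "\<lambda>a. a \<in> I \<and> a \<noteq> 0" _ "\<lambda>a. card {s. coeff a s \<noteq> 0}"] by metis
  have ns: "\<not> singular a"
    using sing a(2) by (auto simp: singular_ideal_def)
  obtain s where s: "coeff a s \<noteq> 0"
    using a(2) contracted_eqI[of a 0] by auto
  have "a = monomial s (coeff a s)"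
  proof -
    have "t = s" if "coeff a t \<noteq> 0" for t
      by (rule minimal_support_singleton[OF I cf a(1) ns _ that s]) (rule minimal)
    then show ?thesis
      using eq_sum_monomial[of "{s}" a] by auto
  qed
  then have "scale (inverse (coeff a s)) a = of_semigroup s"
    using s by (metis left_inverse of_semigroup_def scale_monomial)
  then have "of_semigroup s \<in> I"
    using two_sided_idealD(3)[OF I a(1)] by metis
  moreover have "s \<noteq> 0"
    using s by auto
  \<comment> \<open>The elements of the semigroup whose images lie in I form a semigroup ideal,
    which contains the non-zero s.\<close>
  ultimately have "{t. of_semigroup t \<in> I} = UNIV"
    by (intro semigroup_ideal_eq_UNIV[OF cf])
      (auto simp: of_semigroup_mult[symmetric] two_sided_idealD(4,5)[OF I])
  then have "of_semigroup t \<in> I" for t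
    by blast
  then have "b \<in> I" for b
    by (induction b rule: contracted_algebra_induct)
      (simp_all add: monomial_eq_scale two_sided_idealD(2,3)[OF I])
  then show ?thesis
    by blast
qed

theorem theoremB:
  assumes "\<exists>s::'s::inverse_semigroup_0. s \<noteq> 0"
  shows "simple_algebra (scale :: 'k::field \<Rightarrow> ('s, 'k) contracted_algebra \<Rightarrow> ('s, 'k) contracted_algebra)
    \<longleftrightarrow> congruence_free TYPE('s) \<and> (singular_ideal :: ('s, 'k) contracted_algebra set) = {0}"
proof -
  obtain s :: 's where s: "s \<noteq> 0"
    using assms by blast
  have "(of_semigroup s :: ('s, 'k) contracted_algebra) \<noteq> 0"
    using s by (simp add: of_semigroup_eq_0_iff)
  then have "simple_algebra (scale :: 'k \<Rightarrow> ('s, 'k) contracted_algebra \<Rightarrow> _)"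
    if "congruence_free TYPE('s)" "(singular_ideal :: ('s, 'k) contracted_algebra set) = {0}"
    unfolding simple_algebra_def using congruence_free_imp_ideal_eq_UNIV[OF _ that] by blast
  then show ?thesis
    using simple_imp_congruence_free[where ?'s = 's and ?'k = 'k]
      simple_imp_singular_ideal_trivial[where ?'k = 'k, OF _ s] by blast
qed

end
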